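(* Let $N,n\ge 1$ and $s\ge 1$ be integers, and let $\frac{\mathrm{d}\boldsymbol{u}}{\mathrm{d}t} = \mathsf{P}\boldsymbol{u}$, with $\boldsymbol{u}(t)\in\mathbb{R}^{nN}$ the vector of nodal values of the conservative variables, be an entropy-stable semi-discretization with respect to the norm matrix $\mathsf{H}$ and the convex entropy $\mathcal{S}$. Let $\boldsymbol{w}\in\mathbb{R}^{nN}$ denote the vector of nodal entropy variables corresponding to $\boldsymbol{u}$, and let $$\mathsf{A}_{\mathsf{D}} = -\varepsilon\, \mathsf{H}^{-1}\tilde{\mathsf{D}}_s^{\mathrm{T}}\,\mathsf{C}\,\tilde{\mathsf{D}}_s$$ be an artificial dissipation operator as defined in the context, with $\mathsf{C}$ positive semi-definite. Then the augmented semi-discretization $$\frac{\mathrm{d}\boldsymbol{u}}{\mathrm{d}t} = \mathsf{P}\boldsymbol{u} + \mathsf{A}_{\mathsf{D}}\boldsymbol{w}$$ is entropy-stable.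
   Context: Setting: semi-discretizations in one space dimension, on $N$ nodes, of a system of $n$ conservation laws $\partial_t\boldsymbol{\mathcal{U}}+\partial_x\boldsymbol{\mathcal{F}}=0$ endowed with a differentiable convex entropy function $\mathcal{S}(\boldsymbol{\mathcal{U}})\in\mathbb{R}$. $\mathsf{P}\boldsymbol{u}$ denotes a (possibly nonlinear) summation-by-parts semi-discretization in which homogeneous boundary conditions are implicitly enforced. Entropy variables: $\boldsymbol{\mathcal{W}}=\partial\mathcal{S}/\partial\boldsymbol{\mathcal{U}}\in\mathbb{R}^n$. For a nodal state $\boldsymbol{u}=(\boldsymbol{u}_1,\dots,\boldsymbol{u}_N)$ with $\boldsymbol{u}_j\in\mathbb{R}^n$ (in the domain of $\mathcal{S}$), $\boldsymbol{w}=(\boldsymbol{w}_1,\dots,\boldsymbol{w}_N)$ with $\boldsymbol{w}_j=\frac{\partial\mathcal{S}}{\partial\boldsymbol{\mathcal{U}}}(\boldsymbol{u}_j)$, and $\boldsymbol{s}=[\mathcal{S}(\boldsymbol{u}_1),\dots,\mathcal{S}(\boldsymbol{u}_N)]^{\mathrm{T}}\in\mathbb{R}^N$. Norm matrix: $\mathsf{H}^{(1\mathrm{D})}\in\mathbb{R}^{N\times N}$ is diagonal and positive definite, and $\mathsf{H}=\mathsf{H}^{(1\mathrm{D})}\otimes \mathsf{I}_n$, where $\mathsf{I}_n$ is the $n\times n$ identity. Undivided derivative operator: let $\tilde{\boldsymbol{x}}=[\tilde x_1,\dots,\tilde x_N]^{\mathrm{T}}$ with $0\le\tilde x_1<\dots<\tilde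 x_N\le N-1$ be the nodes on the reference domain $[0,N-1]$, with powers $\tilde{\boldsymbol{x}}^i$ taken entrywise. $\tilde{\mathsf{D}}_s^{(1\mathrm{D})}\in\mathbb{R}^{N\times N}$ is a matrix satisfying $\tilde{\mathsf{D}}_s^{(1\mathrm{D})}\tilde{\boldsymbol{x}}^i=\boldsymbol{0}$ for $i=0,\dots,s-1$ and $\tilde{\mathsf{D}}_s^{(1\mathrm{D})}\tilde{\boldsymbol{x}}^s = s!\,\boldsymbol{1}$, where $\boldsymbol{1}=[1,\dots,1]^{\mathrm{T}}\in\mathbb{R}^N$; and $\tilde{\mathsf{D}}_s=\tilde{\mathsf{D}}_s^{(1\mathrm{D})}\otimes\mathsf{I}_n$. Dissipation parameters: $\varepsilon\ge 0$ is a real number and $\mathsf{C}\in\mathbb{R}^{nN\times nN}$ is symmetric (and may depend on the state $\boldsymbol{u}$, in which case positive semi-definiteness is required at every state). Entropy stability: a semi-discretization $\frac{\mathrm{d}\boldsymbol{u}}{\mathrm{d}t}=\boldsymbol{R}(\boldsymbol{u})$ (with homogeneous boundary conditions) is entropy-stable with respect to $\mathsf{H}$ and $\mathcal{S}$ if the discrete total entropy is non-increasing, i.e. $\boldsymbol{1}^{\mathrm{T}}\mathsf{H}^{(1\mathrm{D})}\frac{\mathrm{d}\boldsymbol{s}}{\mathrm{d}t}=\boldsymbol{w}^{\mathrm{T}}\mathsf{H}\frac{\mathrm{d}\boldsymbol{u}}{\mathrm{d}t}=\boldsymbol{w}^{\mathrm{T}}\mathsf{H}\boldsymbol{R}(\boldsymbol{u})\le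 0$ for every admissible state $\boldsymbol{u}$. *)

theory Defs
  imports "HOL-Analysis.Analysis"
begin

text \<open>
  A vector of nodal values in \<open>\<real>\<^bsup>nN\<^esup>\<close> is an element of \<open>real ^ ('N \<times> 'n)\<close>: the entry
  \<open>(j, k)\<close> is component \<open>k\<close> at node \<open>j\<close>, which is the index order that goes with
  \<open>A \<otimes> I\<^sub>n\<close>.
\<close>

definition kronecker ::
    "real ^ 'b ^ 'a \<Rightarrow> real ^ 'd ^ 'c \<Rightarrow> real ^ ('b::finite \<times> 'd::finite) ^ ('a::finite \<times> 'c::finite)"
  where "kronecker A B = (\<chi> p q. A $ fst p $ fst q * B $ snd p $ snd q)"

definition diagonal_matrix :: "real ^ 'a ^ 'a \<Rightarrow> bool"
  where "diagonal_matrix A \<longleftrightarrow> (\<forall>i j. i \<noteq> j \<longrightarrow> A $ i $ j = 0)"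

definition symmetric_matrix :: "real ^ 'a ^ 'a \<Rightarrow> bool"
  where "symmetric_matrix A \<longleftrightarrow> transpose A = A"

definition positive_definite :: "real ^ 'a ^ 'a \<Rightarrow> bool"
  where "positive_definite A \<longleftrightarrow> symmetric_matrix A \<and> (\<forall>v. v \<noteq> 0 \<longrightarrow> v \<bullet> (A *v v) > 0)"

definition positive_semidefinite :: "real ^ 'a ^ 'a \<Rightarrow> bool"
  where "positive_semidefinite A \<longleftrightarrow> symmetric_matrix A \<and> (\<forall>v. v \<bullet> (A *v v) \<ge> 0)"

definition node :: "real ^ ('N::finite \<times> 'n::finite) \<Rightarrow> 'N \<Rightarrow> real ^ 'n"
  where "node u j = (\<chi> k. u $ (j, k))"

definition admissible :: "(real ^ 'n::finite) set \<Rightarrow> real ^ ('N::finite \<times> 'n) \<Rightarrow> bool"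
  where "admissible \<Omega> u \<longleftrightarrow> (\<forall>j. node u j \<in> \<Omega>)"

definition nodal_entropy :: "(real ^ 'n::finite \<Rightarrow> real) \<Rightarrow> real ^ ('N::finite \<times> 'n) \<Rightarrow> real ^ 'N"
  where "nodal_entropy S u = (\<chi> j. S (node u j))"

text \<open>The gradient of the entropy, as the vector of its partial derivatives.\<close>

definition entropy_gradient :: "(real ^ 'n::finite \<Rightarrow> real) \<Rightarrow> real ^ 'n \<Rightarrow> real ^ 'n"
  where "entropy_gradient S U = (\<chi> k. frechet_derivative S (at U) (axis k 1))"

definition entropy_variables ::
    "(real ^ 'n::finite \<Rightarrow> real) \<Rightarrow> real ^ ('N::finite \<times> 'n) \<Rightarrow> real ^ ('N \<times> 'n)"
  where "entropy_variables S u = (\<chi> p. entropy_gradient S (node u (fst p)) $ snd p)"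

definition norm_matrix :: "real ^ 'N ^ 'N \<Rightarrow> real ^ ('N::finite \<times> 'n::finite) ^ ('N \<times> 'n)"
  where "norm_matrix H1 = kronecker H1 (mat 1)"

text \<open>
  Arithmetic on \<open>real ^ 'N\<close> is entrywise, so \<open>x ^ i\<close> is the entrywise power and \<open>1\<close> the
  vector of ones.
\<close>

definition undivided_derivative :: "nat \<Rightarrow> real ^ 'N \<Rightarrow> real ^ 'N ^ 'N \<Rightarrow> bool"
  where "undivided_derivative s x D \<longleftrightarrow>
    (\<forall>i<s. D *v (x ^ i) = 0) \<and> D *v (x ^ s) = fact s *\<^sub>R 1"

definition dissipation_operator ::
    "real \<Rightarrow> real ^ 'N ^ 'N \<Rightarrow> real ^ 'N ^ 'N \<Rightarrow> real ^ ('N \<times> 'n) ^ ('N \<times> 'n)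
      \<Rightarrow> real ^ ('N::finite \<times> 'n::finite) ^ ('N \<times> 'n)"
  where "dissipation_operator \<epsilon> H1 D1 C =
    (let D = kronecker D1 (mat 1)
     in - (\<epsilon> *\<^sub>R (matrix_inv (norm_matrix H1) ** transpose D ** C ** D)))"

text \<open>
  Entropy stability of \<open>du/dt = R u\<close>. By the chain rule, the quantity bounded here is the
  rate of change of the discrete total entropy along solutions; see
  \<open>total_entropy_has_derivative\<close> and \<open>entropy_stable_total_entropy_nonincreasing\<close> below.
\<close>

definition entropy_stable ::
    "real ^ 'N ^ 'N \<Rightarrow> (real ^ 'n::finite) set \<Rightarrow> (real ^ 'n \<Rightarrow> real)
      \<Rightarrow> (real ^ ('N::finite \<times> 'n) \<Rightarrow> real ^ ('N \<times> 'n)) \<Rightarrow> bool"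
  where "entropy_stable H1 \<Omega> S R \<longleftrightarrow>
    (\<forall>u. admissible \<Omega> u \<longrightarrow> entropy_variables S u \<bullet> (norm_matrix H1 *v R u) \<le> 0)"

lemma vec_power_nth: "(x ^ i) $ j = (x $ j) ^ i" for x :: "real ^ 'N"
  by (induction i) simp_all

lemma entropy_gradient_gderiv:
  assumes "S differentiable (at U)"
  shows "GDERIV S U :> entropy_gradient S U"
proof -
  let ?F = "frechet_derivative S (at U)"
  have F: "(S has_derivative ?F) (at U)"
    using assms frechet_derivative_works by blast
  then have lin: "linear ?F"
    by (rule has_derivative_linear)
  have "?F h = h \<bullet> entropy_gradient S U" for h
  proof -
    have "?F h = ?F (\<Sum>k\<in>UNIV. h $ k *\<^sub>R axis k 1)"
      by (metis (no_types, lifting) basis_expansion scalar_mult_eq_scaleR sum.cong)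
    also have "\<dots> = (\<Sum>k\<in>UNIV. h $ k * ?F (axis k 1))"
      by (simp add: linear_sum[OF lin] linear_cmul[OF lin])
    finally show ?thesis
      by (simp add: inner_vec_def entropy_gradient_def)
  qed
  then have "?F = (\<lambda>h. h \<bullet> entropy_gradient S U)" by blast
  with F show ?thesis by (simp add: gderiv_def)
qed

lemma diagonal_norm_matrix_mult_nth:
  fixes H1 :: "real ^ 'N ^ 'N" and v :: "real ^ ('N::finite \<times> 'n::finite)"
  assumes "diagonal_matrix H1"
  shows "(norm_matrix H1 *v v) $ p = H1 $ fst p $ fst p * v $ p"
proof -
  have "(norm_matrix H1 *v v) $ p = (\<Sum>q\<in>UNIV. norm_matrix H1 $ p $ q * v $ q)"
    by (simp add: matrix_vector_mult_def)
  also have "\<dots> = (\<Sum>q\<in>UNIV. if q = p then H1 $ fst p $ fst p * v $ p else 0)"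
    using assms
    by (intro sum.cong) (auto simp: norm_matrix_def kronecker_def diagonal_matrix_def mat_def prod_eq_iff)
  finally show ?thesis by simp
qed

lemma diagonal_mult_nth:
  assumes "diagonal_matrix A"
  shows "(A *v v) $ j = A $ j $ j * v $ j"
proof -
  have "(A *v v) $ j = (\<Sum>q\<in>UNIV. A $ j $ q * v $ q)"
    by (simp add: matrix_vector_mult_def)
  also have "\<dots> = (\<Sum>q\<in>UNIV. if q = j then A $ j $ j * v $ j else 0)"
    using assms by (intro sum.cong) (auto simp: diagonal_matrix_def)
  finally show ?thesis by simp
qed

lemma total_entropy_has_derivative:
  fixes u :: "real \<Rightarrow> real ^ ('N::finite \<times> 'n::finite)"
  assumes "diagonal_matrix H1"
    and S: "\<And>j. S differentiable (at (node (u t) j))"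
    and u: "(u has_vector_derivative u') (at t within T)"
  shows "((\<lambda>\<tau>. 1 \<bullet> (H1 *v nodal_entropy S (u \<tau>))) has_real_derivative
    entropy_variables S (u t) \<bullet> (norm_matrix H1 *v u')) (at t within T)"
proof -
  have lin: "bounded_linear (\<lambda>v :: real ^ ('N \<times> 'n). node v j)" for j
    unfolding linear_conv_bounded_linear[symmetric]
    by (rule linearI) (simp_all add: node_def vec_eq_iff)
  have nd: "((\<lambda>\<tau>. node (u \<tau>) j) has_derivative (\<lambda>h. h *\<^sub>R node u' j)) (at t within T)" for j
    using bounded_linear.has_vector_derivative[OF lin u]
    by (simp add: has_vector_derivative_def)
  have "((\<lambda>\<tau>. S (node (u \<tau>) j)) has_real_derivative
      node u' j \<bullet> entropy_gradient S (node (u t) j)) (at t within T)" for j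
  proof -
    have "((\<lambda>\<tau>. S (node (u \<tau>) j)) has_derivative
        (\<lambda>h. (h *\<^sub>R node u' j) \<bullet> entropy_gradient S (node (u t) j))) (at t within T)"
      by (rule has_derivative_compose[OF nd entropy_gradient_gderiv[OF S, unfolded gderiv_def]])
    then show ?thesis
      by (rule has_derivative_imp_has_field_derivative) simp
  qed
  then have "((\<lambda>\<tau>. \<Sum>j\<in>UNIV. H1 $ j $ j * S (node (u \<tau>) j)) has_real_derivative
      (\<Sum>j\<in>UNIV. H1 $ j $ j * (node u' j \<bullet> entropy_gradient S (node (u t) j)))) (at t within T)"
    by (intro DERIV_sum DERIV_cmult)
  moreover have "1 \<bullet> (H1 *v nodal_entropy S v) = (\<Sum>j\<in>UNIV. H1 $ j $ j * S (node v j))" for v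
    by (simp add: inner_vec_def diagonal_mult_nth[OF assms(1)] nodal_entropy_def)
  moreover have "entropy_variables S (u t) \<bullet> (norm_matrix H1 *v u') =
      (\<Sum>j\<in>UNIV. H1 $ j $ j * (node u' j \<bullet> entropy_gradient S (node (u t) j)))"
  proof -
    have "entropy_variables S (u t) \<bullet> (norm_matrix H1 *v u') =
        (\<Sum>(j, k)\<in>UNIV \<times> UNIV. entropy_gradient S (node (u t) j) $ k * (H1 $ j $ j * u' $ (j, k)))"
      by (simp add: inner_vec_def diagonal_norm_matrix_mult_nth[OF assms(1)] entropy_variables_def
          split_beta)
    also have "\<dots> = (\<Sum>j\<in>UNIV. \<Sum>k\<in>UNIV.
        entropy_gradient S (node (u t) j) $ k * (H1 $ j $ j * u' $ (j, k)))"
      by (rule sum.cartesian_product[symmetric])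
    also have "\<dots> = (\<Sum>j\<in>UNIV. H1 $ j $ j * (node u' j \<bullet> entropy_gradient S (node (u t) j)))"
      by (intro sum.cong refl) (simp add: inner_vec_def node_def sum_distrib_left mult_ac)
    finally show ?thesis .
  qed
  ultimately show ?thesis by simp
qed

corollary entropy_stable_total_entropy_nonincreasing:
  fixes u :: "real \<Rightarrow> real ^ ('N::finite \<times> 'n::finite)"
  assumes "diagonal_matrix H1"
    and S: "\<And>U. U \<in> \<Omega> \<Longrightarrow> S differentiable (at U)"
    and R: "entropy_stable H1 \<Omega> S R"
    and u: "\<And>t. a \<le> t \<Longrightarrow> t \<le> b \<Longrightarrow> (u has_vector_derivative R (u t)) (at t within {a..b})"
    and adm: "\<And>t. a \<le> t \<Longrightarrow> t \<le> b \<Longrightarrow> admissible \<Omega> (u t)"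
    and "a \<le> b"
  shows "1 \<bullet> (H1 *v nodal_entropy S (u b)) \<le> 1 \<bullet> (H1 *v nodal_entropy S (u a))"
proof (rule DERIV_nonpos_imp_decreasing_open[OF \<open>a \<le> b\<close>])
  note der = total_entropy_has_derivative[OF assms(1) S u]
  have D: "((\<lambda>\<tau>. 1 \<bullet> (H1 *v nodal_entropy S (u \<tau>))) has_real_derivative
    entropy_variables S (u t) \<bullet> (norm_matrix H1 *v R (u t))) (at t within {a..b})"
    if "a \<le> t" "t \<le> b" for t
    using der that adm[OF that] by (simp add: admissible_def)
  show "continuous_on {a..b} (\<lambda>\<tau>. 1 \<bullet> (H1 *v nodal_entropy S (u \<tau>)))"
    using D by (intro DERIV_continuous_on) auto
  show "\<exists>y. ((\<lambda>\<tau>. 1 \<bullet> (H1 *v nodal_entropy S (u \<tau>))) has_real_derivative y) (at t) \<and> y \<le> 0"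
    if "a < t" "t < b" for t
    using D[of t] that R adm[of t] at_within_Icc_at[of a t b]
    by (auto simp: entropy_stable_def)
qed

end

theory Submission
  imports Defs
begin

text \<open>
  The rate of change of the discrete total entropy is linear in the right-hand side of the
  semi-discretization, so it is enough that the dissipation term contributes a nonpositive amount.
  The factor \<open>H\<^sup>-\<^sup>1\<close> in the operator is there to cancel the weight \<open>H\<close> of the entropy balance,
  which leaves minus a quadratic form in the undivided derivative of the entropy variables,
  \<open>w \<bullet> H (A w) = - \<epsilon> (w \<bullet> D\<^sup>T C D w) = - \<epsilon> ((D w) \<bullet> C (D w)) \<le> 0\<close>
  (lemma \<open>dissipation_entropy_production\<close>). The operator is applied to the entropy variables
  \<open>w\<close> rather than to \<open>u\<close> precisely so that both arguments of the form agree.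
\<close>

lemma uminus_matrix_vector_mult: "(- A) *v v = - (A *v v)" for A :: "real ^ 'a ^ 'b"
  by (simp add: matrix_vector_mult_def vec_eq_iff sum_negf)

lemma inner_transpose_mult: "v \<bullet> (transpose A *v y) = (A *v v) \<bullet> y" for A :: "real ^ 'a ^ 'b"
  by (metis dot_lmul_matrix inner_commute transpose_matrix_vector)

lemma matrix_mul_matrix_inv:
  assumes "invertible A"
  shows "A ** matrix_inv A = mat 1"
  using someI_ex[OF assms[unfolded invertible_def]] by (simp add: matrix_inv_def)

lemma positive_definite_diagonal_entry_pos:
  assumes "positive_definite A"
  shows "A $ j $ j > 0"
proof -
  have "axis j 1 \<bullet> (A *v axis j 1) > 0"
    using assms by (simp add: positive_definite_def axis_eq_0_iff)
  then show ?thesis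
    by (simp add: inner_axis' matrix_vector_mul_component inner_axis)
qed

text \<open>
  The inverse of a singular matrix is an arbitrary matrix, so the cancellation of \<open>H\<close> needs this.
  Acting entrywise by positive weights, \<open>H\<close> has trivial kernel.
\<close>

lemma invertible_norm_matrix:
  fixes H1 :: "real ^ 'N ^ 'N"
  assumes diag: "diagonal_matrix H1" and pd: "positive_definite H1"
  shows "invertible (norm_matrix H1 :: real ^ ('N::finite \<times> 'n::finite) ^ ('N \<times> 'n))"
proof -
  have "v = 0" if "norm_matrix H1 *v v = 0" for v :: "real ^ ('N \<times> 'n)"
  proof -
    have "H1 $ fst p $ fst p * v $ p = 0" for p
      using diagonal_norm_matrix_mult_nth[OF diag, of v p] that by simp
    moreover have "H1 $ fst p $ fst p \<noteq> 0" for p :: "'N \<times> 'n"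
      using positive_definite_diagonal_entry_pos[OF pd, of "fst p"] by simp
    ultimately show ?thesis
      by (simp add: vec_eq_iff)
  qed
  then show ?thesis
    by (simp add: invertible_left_inverse matrix_left_invertible_ker)
qed

lemma norm_matrix_mult_dissipation_operator:
  fixes H1 :: "real ^ 'N ^ 'N" and w :: "real ^ ('N::finite \<times> 'n::finite)"
  assumes "invertible (norm_matrix H1 :: real ^ ('N \<times> 'n) ^ ('N \<times> 'n))"
  shows "norm_matrix H1 *v (dissipation_operator \<epsilon> H1 D1 C *v w) =
    - (\<epsilon> *\<^sub>R (transpose (kronecker D1 (mat 1)) *v (C *v (kronecker D1 (mat 1) *v w))))"
proof -
  let ?H = "norm_matrix H1 :: real ^ ('N \<times> 'n) ^ ('N \<times> 'n)"
  let ?D = "kronecker D1 (mat 1) :: real ^ ('N \<times> 'n) ^ ('N \<times> 'n)"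
  let ?M = "transpose ?D ** C ** ?D"
  have "dissipation_operator \<epsilon> H1 D1 C *v w = - (\<epsilon> *\<^sub>R (matrix_inv ?H *v (?M *v w)))"
    by (simp add: dissipation_operator_def Let_def uminus_matrix_vector_mult
        scaleR_matrix_vector_assoc[symmetric] matrix_vector_mul_assoc matrix_mul_assoc)
  then have "?H *v (dissipation_operator \<epsilon> H1 D1 C *v w) =
      - (\<epsilon> *\<^sub>R ((?H ** matrix_inv ?H) *v (?M *v w)))"
    by (simp add: linear_neg[OF matrix_vector_mul_linear] matrix_vector_mult_scaleR
        matrix_vector_mul_assoc matrix_mul_assoc)
  also have "?H ** matrix_inv ?H = mat 1"
    by (rule matrix_mul_matrix_inv[OF assms])
  finally show ?thesis
    by (simp add: matrix_vector_mul_assoc matrix_mul_assoc)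
qed

text \<open>
  Moving the transposed derivative to the other side of the inner product exhibits the entropy
  production of the dissipation as a multiple of the quadratic form of \<open>C\<close>.
\<close>

lemma dissipation_entropy_production:
  fixes H1 D1 :: "real ^ 'N ^ 'N" and w :: "real ^ ('N::finite \<times> 'n::finite)"
  assumes "invertible (norm_matrix H1 :: real ^ ('N \<times> 'n) ^ ('N \<times> 'n))"
  defines "d \<equiv> kronecker D1 (mat 1) *v w"
  shows "w \<bullet> (norm_matrix H1 *v (dissipation_operator \<epsilon> H1 D1 C *v w)) = - (\<epsilon> * (d \<bullet> (C *v d)))"
  by (simp add: norm_matrix_mult_dissipation_operator[OF assms(1)] inner_transpose_mult d_def
      del: transpose_matrix_vector)

theorem theorem3:
  fixes H1 D1 :: "real ^ 'N::{finite,linorder} ^ 'N::{finite,linorder}"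
    and x :: "real ^ 'N::{finite,linorder}"
    and \<Omega> :: "(real ^ 'n::finite) set"
    and S :: "real ^ 'n \<Rightarrow> real"
    and P :: "real ^ ('N \<times> 'n) \<Rightarrow> real ^ ('N \<times> 'n)"
    and C :: "real ^ ('N \<times> 'n) \<Rightarrow> real ^ ('N \<times> 'n) ^ ('N \<times> 'n)"
    and \<epsilon> :: real
    and s :: nat
  assumes "s \<ge> 1"
    and "convex_on \<Omega> S" and "\<And>U. U \<in> \<Omega> \<Longrightarrow> S differentiable (at U)"
    and "diagonal_matrix H1" and "positive_definite H1"
    and "strict_mono (\<lambda>j. x $ j)" and "\<And>j. 0 \<le> x $ j \<and> x $ j \<le> real CARD('N) - 1"
    and "undivided_derivative s x D1"
    and "\<epsilon> \<ge> 0"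
    and "\<And>u. admissible \<Omega> u \<Longrightarrow> symmetric_matrix (C u)"
    and "\<And>u. admissible \<Omega> u \<Longrightarrow> positive_semidefinite (C u)"
    and "entropy_stable H1 \<Omega> S P"
  shows "entropy_stable H1 \<Omega> S
    (\<lambda>u. P u + dissipation_operator \<epsilon> H1 D1 (C u) *v entropy_variables S u)"
  unfolding entropy_stable_def
proof (intro allI impI)
  fix u :: "real ^ ('N \<times> 'n)"
  assume u: "admissible \<Omega> u"
  let ?w = "entropy_variables S u"
  let ?d = "kronecker D1 (mat 1) *v ?w"
  have inv: "invertible (norm_matrix H1 :: real ^ ('N \<times> 'n) ^ ('N \<times> 'n))"
    by (rule invertible_norm_matrix) fact+
  have "?d \<bullet> (C u *v ?d) \<ge> 0"
    using assms(11)[OF u] by (simp add: positive_semidefinite_def)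
  then have "?w \<bullet> (norm_matrix H1 *v (dissipation_operator \<epsilon> H1 D1 (C u) *v ?w)) \<le> 0"
    using \<open>\<epsilon> \<ge> 0\<close> by (simp add: dissipation_entropy_production[OF inv])
  moreover have "?w \<bullet> (norm_matrix H1 *v P u) \<le> 0"
    using assms(12) u by (simp add: entropy_stable_def)
  ultimately show "?w \<bullet> (norm_matrix H1 *v
      (P u + dissipation_operator \<epsilon> H1 D1 (C u) *v ?w)) \<le> 0"
    by (simp add: matrix_vector_right_distrib inner_add_right)
qed

end
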